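(* Let $T\in(0,\infty)$ be arbitrary and let $\{T_n\}_{n\ge0}\subset(0,\infty)$ be any sequence decreasing monotonically to $T$. Let $D_{0,T}(\cdot,\cdot)$ (resp. $D_{0,T_n}(\cdot,\cdot)$) be the payoff of the Dynkin game with horizon $[0,T]$ and terminal value $\Gamma^T$ (resp. horizon $[0,T_n]$ and terminal value $\Gamma^{T_n}$). Suppose that - each $\Gamma^{T_n}$ is $\mathcal{F}_{T_n}$-measurable; - $L_{T_n}\le\Gamma^{T_n}\le U_{T_n}$ for every $n$; - $\Gamma^{T_n}\to\Gamma^T$ almost surely as $n\to\infty$; - $\sup_{n\ge0}|\Gamma^{T_n}|\in L^2$. Then, letting $V^T_0$ and $V^{T_n}_0$ denote the values of these games, $$\lim_{n\to\infty}|V^{T_n}_0-V^T_0|^2=0,$$ and the map $T\mapsto V^T_0$ is therefore right-continuous on $(0,\infty)$ (when the family of terminal values $(\Gamma^T)_{T>0}$ is such that, for every $T\in(0,\infty)$ and every sequence $\{T_n\}_{n\ge0}\subset(0,\infty)$ with $T_n\downarrow T$, each $\Gamma^{T_n}$ is $\mathcal{F}_{T_n}$-measurable, $L_{T_n}\le\Gamma^{T_n}\le U_{T_n}$ for every $n$, $\Gamma^{T_n}\to\Gamma^T$ almost surely as $n\to\infty$, and $\sup_{n\ge0}|\Gamma^{T_n}|\in L^2$).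
   Context: Setting. $(\Omega,\mathcal{F},\mathsf{P})$ is a complete probability space carrying a standard Brownian motion $B=(B_t)_{t\ge0}$, $\mathbb{F}=(\mathcal{F}_t)_{t\ge0}$ is the completed natural filtration of $B$, and $\mathcal{F}=\bigvee_t\mathcal{F}_t$. For $0<T<\infty$, $\mathbb{F}_T=(\mathcal{F}_t)_{0\le t\le T}$ and $\mathcal{T}_{t,T}$ is the set of $\mathbb{F}_T$-stopping times $\nu$ with $t\le\nu\le T$ $\mathsf{P}$-a.s. $L^2$ is the set of random variables $Z$ with $\mathsf{E}[|Z|^2]<\infty$. Barriers. $\mathcal{S}^2$ is the set of $\mathbb{F}$-progressively measurable processes $X$ with $\mathsf{E}[(\sup_{t\ge0}|X_t|)^2]<\infty$; $\mathcal{Q}$ is the set of $\mathbb{F}$-adapted càdlàg processes which are quasi-left-continuous (left-continuous over stopping times); in this Brownian filtration, processes in $\mathcal{Q}$ have a.s. continuous paths. Stopping costs $\gamma_-,\gamma_+\in\mathcal{S}^2\cap\mathcal{Q}$, defined on $[0,\infty)$, are given, and $L_t=-\gamma_+(t)$, $U_t=\gamma_-(t)$. It is assumed that for all $t$, $\gamma_-(t)+\gamma_+(t)>0$ $\mathsf{P}$-a.s. (i.e. $L_t<U_t$). There is no running payoff ($\psi\equiv0$). Game. For $0<T<\infty$ the terminal value $\Gamma^T\in L^2$ is $\mathcal{F}_T$-measurable with $L_T\le\Gamma^T\le U_T$ $\mathsf{P}$-a.s., and for $t\in[0,T]$, $\sigma,\tau\in\mathcal{T}_{t,T}$, $$D_{t,T}(\sigma,\tau)=\mathsf{E}\big[U_\sigma\mathbf{1}_{\{\sigma\le\tau\}}\mathbf{1}_{\{\sigma<T\}}+L_\tau\mathbf{1}_{\{\tau<\sigma\}}+\Gamma^T\mathbf{1}_{\{\sigma=\tau=T\}}\,\big|\,\mathcal{F}_t\big].$$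 The value of the game with horizon $[0,T]$ is the common value $$V^T_0=\operatorname*{ess\,inf}_{\sigma\in\mathcal{T}_{0,T}}\operatorname*{ess\,sup}_{\tau\in\mathcal{T}_{0,T}}D_{0,T}(\sigma,\tau)=\operatorname*{ess\,sup}_{\tau\in\mathcal{T}_{0,T}}\operatorname*{ess\,inf}_{\sigma\in\mathcal{T}_{0,T}}D_{0,T}(\sigma,\tau),$$ which exists under these assumptions and is deterministic since $\mathcal{F}_0$ is trivial. *)

theory Defs
  imports "HOL-Probability.Probability"
begin

text \<open>
  Time is modelled by the type of reals; processes \<open>X :: real \<Rightarrow> 'a \<Rightarrow> real\<close> are only
  meaningful at times \<open>t \<ge> 0\<close>.
\<close>

section \<open>Brownian motion and its completed filtration\<close>

definition standard_brownian_motion :: "'a measure \<Rightarrow> (real \<Rightarrow> 'a \<Rightarrow> real) \<Rightarrow> bool" where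
  "standard_brownian_motion M B \<longleftrightarrow>
     (\<forall>t\<ge>0. B t \<in> borel_measurable M) \<and>
     (AE \<omega> in M. B 0 \<omega> = 0) \<and>
     (\<forall>s t. 0 \<le> s \<and> s < t \<longrightarrow>
        distributed M lborel (\<lambda>\<omega>. B t \<omega> - B s \<omega>) (normal_density 0 (sqrt (t - s)))) \<and>
     (\<forall>(t :: nat \<Rightarrow> real) n. 0 \<le> t 0 \<and> mono t \<longrightarrow>
        prob_space.indep_vars M (\<lambda>_. borel) (\<lambda>i \<omega>. B (t (Suc i)) \<omega> - B (t i) \<omega>) {..<n}) \<and>
     (AE \<omega> in M. continuous_on {0..} (\<lambda>t. B t \<omega>))"

text \<open>
  For \<open>t < 0\<close> this is the sigma-algebra generated by the null sets alone. Hence, for \<open>\<nu> \<ge> 0\<close> a.s.,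
  the library notion \<^const>\<open>stopping_time\<close>, which quantifies over all real \<open>t\<close>, imposes nothing
  at negative times.
\<close>

definition completed_filtration :: "'a measure \<Rightarrow> (real \<Rightarrow> 'a \<Rightarrow> real) \<Rightarrow> real \<Rightarrow> 'a measure" where
  "completed_filtration M B t =
     sigma (space M)
       ({B s -` A \<inter> space M | s A. 0 \<le> s \<and> s \<le> t \<and> A \<in> sets borel} \<union> null_sets M)"

section \<open>Classes of processes\<close>

definition adapted :: "(real \<Rightarrow> 'a measure) \<Rightarrow> (real \<Rightarrow> 'a \<Rightarrow> real) \<Rightarrow> bool" where
  "adapted F X \<longleftrightarrow> (\<forall>t\<ge>0. X t \<in> borel_measurable (F t))"

definition progressively_measurable :: "(real \<Rightarrow> 'a measure) \<Rightarrow> (real \<Rightarrow> 'a \<Rightarrow> real) \<Rightarrow> bool" where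
  "progressively_measurable F X \<longleftrightarrow>
     (\<forall>t\<ge>0. (\<lambda>(s, \<omega>). X s \<omega>) \<in> borel_measurable (restrict_space borel {0..t} \<Otimes>\<^sub>M F t))"

definition process_S2 :: "'a measure \<Rightarrow> (real \<Rightarrow> 'a measure) \<Rightarrow> (real \<Rightarrow> 'a \<Rightarrow> real) set" where
  "process_S2 M F =
     {X. progressively_measurable F X \<and>
         (\<integral>\<^sup>+ \<omega>. (SUP t\<in>{0..}. ennreal \<bar>X t \<omega>\<bar>)\<^sup>2 \<partial>M) < \<infinity>}"

definition cadlag :: "(real \<Rightarrow> real) \<Rightarrow> bool" where
  "cadlag x \<longleftrightarrow>
     (\<forall>t\<ge>0. continuous (at_right t) x) \<and> (\<forall>t>0. \<exists>l. (x \<longlongrightarrow> l) (at_left t))"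

text \<open>
  Almost surely on the event that the limit of the \<open>\<theta> n\<close> is finite, \<open>X\<close> at \<open>\<theta> n\<close> tends to \<open>X\<close> at
  the limit. Finite-valued \<open>\<theta> n\<close> suffice: stopping times with values in \<open>[0, \<infinity>]\<close> can be replaced by
  \<open>min (\<theta> n) n\<close>, which agrees eventually wherever the limit is finite.
\<close>

definition quasi_left_continuous ::
    "'a measure \<Rightarrow> (real \<Rightarrow> 'a measure) \<Rightarrow> (real \<Rightarrow> 'a \<Rightarrow> real) \<Rightarrow> bool" where
  "quasi_left_continuous M F X \<longleftrightarrow>
     (\<forall>\<theta> :: nat \<Rightarrow> 'a \<Rightarrow> real.
        (\<forall>n. stopping_time F (\<theta> n)) \<and>
        (\<forall>\<omega>\<in>space M. (\<forall>n. 0 \<le> \<theta> n \<omega>) \<and> incseq (\<lambda>n. \<theta> n \<omega>)) \<longrightarrow>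
        (AE \<omega> in M. \<forall>r. (\<lambda>n. \<theta> n \<omega>) \<longlonglongrightarrow> r \<longrightarrow> (\<lambda>n. X (\<theta> n \<omega>) \<omega>) \<longlonglongrightarrow> X r \<omega>))"

definition process_Q :: "'a measure \<Rightarrow> (real \<Rightarrow> 'a measure) \<Rightarrow> (real \<Rightarrow> 'a \<Rightarrow> real) set" where
  "process_Q M F =
     {X. adapted F X \<and> (AE \<omega> in M. cadlag (\<lambda>t. X t \<omega>)) \<and> quasi_left_continuous M F X}"

section \<open>Essential supremum and infimum of a family of random variables\<close>

text \<open>
  The library constant \<^const>\<open>esssup\<close> is the essential supremum of a single function. The
  essential supremum of a family is determined up to null sets only; \<open>ess_SUP\<close> and \<open>ess_INF\<close>
  pick a version.
\<close>

definition is_ess_sup :: "'a measure \<Rightarrow> 'i set \<Rightarrow> ('i \<Rightarrow> 'a \<Rightarrow> ereal) \<Rightarrow> ('a \<Rightarrow> ereal) \<Rightarrow> bool" where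
  "is_ess_sup M I X Z \<longleftrightarrow>
     Z \<in> borel_measurable M \<and> (\<forall>i\<in>I. AE \<omega> in M. X i \<omega> \<le> Z \<omega>) \<and>
     (\<forall>Y\<in>borel_measurable M. (\<forall>i\<in>I. AE \<omega> in M. X i \<omega> \<le> Y \<omega>) \<longrightarrow> (AE \<omega> in M. Z \<omega> \<le> Y \<omega>))"

definition is_ess_inf :: "'a measure \<Rightarrow> 'i set \<Rightarrow> ('i \<Rightarrow> 'a \<Rightarrow> ereal) \<Rightarrow> ('a \<Rightarrow> ereal) \<Rightarrow> bool" where
  "is_ess_inf M I X Z \<longleftrightarrow>
     Z \<in> borel_measurable M \<and> (\<forall>i\<in>I. AE \<omega> in M. Z \<omega> \<le> X i \<omega>) \<and>
     (\<forall>Y\<in>borel_measurable M. (\<forall>i\<in>I. AE \<omega> in M. Y \<omega> \<le> X i \<omega>) \<longrightarrow> (AE \<omega> in M. Y \<omega> \<le> Z \<omega>))"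

definition ess_SUP :: "'a measure \<Rightarrow> 'i set \<Rightarrow> ('i \<Rightarrow> 'a \<Rightarrow> ereal) \<Rightarrow> 'a \<Rightarrow> ereal" where
  "ess_SUP M I X = (SOME Z. is_ess_sup M I X Z)"

definition ess_INF :: "'a measure \<Rightarrow> 'i set \<Rightarrow> ('i \<Rightarrow> 'a \<Rightarrow> ereal) \<Rightarrow> 'a \<Rightarrow> ereal" where
  "ess_INF M I X = (SOME Z. is_ess_inf M I X Z)"

section \<open>The Dynkin game\<close>

text \<open>
  When \<open>t \<ge> 0\<close> and \<open>F\<close> contains the null sets, \<^const>\<open>stopping_time\<close> for the whole filtration and
  for its restriction to \<open>[0, T]\<close> coincide on times with \<open>t \<le> \<nu> \<le> T\<close> a.s.
\<close>

definition stopping_times ::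
    "'a measure \<Rightarrow> (real \<Rightarrow> 'a measure) \<Rightarrow> real \<Rightarrow> real \<Rightarrow> ('a \<Rightarrow> real) set" where
  "stopping_times M F t T = {\<nu>. stopping_time F \<nu> \<and> (AE \<omega> in M. t \<le> \<nu> \<omega> \<and> \<nu> \<omega> \<le> T)}"

definition terminal_value ::
    "'a measure \<Rightarrow> (real \<Rightarrow> 'a measure) \<Rightarrow> (real \<Rightarrow> 'a \<Rightarrow> real) \<Rightarrow> (real \<Rightarrow> 'a \<Rightarrow> real) \<Rightarrow>
     real \<Rightarrow> ('a \<Rightarrow> real) \<Rightarrow> bool" where
  "terminal_value M F L U T \<Gamma> \<longleftrightarrow>
     \<Gamma> \<in> borel_measurable (F T) \<and> integrable M (\<lambda>\<omega>. (\<Gamma> \<omega>)\<^sup>2) \<and>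
     (AE \<omega> in M. L T \<omega> \<le> \<Gamma> \<omega> \<and> \<Gamma> \<omega> \<le> U T \<omega>)"

definition game_reward ::
    "(real \<Rightarrow> 'a \<Rightarrow> real) \<Rightarrow> (real \<Rightarrow> 'a \<Rightarrow> real) \<Rightarrow> real \<Rightarrow> ('a \<Rightarrow> real) \<Rightarrow>
     ('a \<Rightarrow> real) \<Rightarrow> ('a \<Rightarrow> real) \<Rightarrow> 'a \<Rightarrow> real" where
  "game_reward L U T \<Gamma> \<sigma> \<tau> \<omega> =
     U (\<sigma> \<omega>) \<omega> * of_bool (\<sigma> \<omega> \<le> \<tau> \<omega>) * of_bool (\<sigma> \<omega> < T)
     + L (\<tau> \<omega>) \<omega> * of_bool (\<tau> \<omega> < \<sigma> \<omega>)
     + \<Gamma> \<omega> * of_bool (\<sigma> \<omega> = T \<and> \<tau> \<omega> = T)"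

definition game_payoff ::
    "'a measure \<Rightarrow> (real \<Rightarrow> 'a measure) \<Rightarrow> (real \<Rightarrow> 'a \<Rightarrow> real) \<Rightarrow> (real \<Rightarrow> 'a \<Rightarrow> real) \<Rightarrow>
     real \<Rightarrow> real \<Rightarrow> ('a \<Rightarrow> real) \<Rightarrow> ('a \<Rightarrow> real) \<Rightarrow> ('a \<Rightarrow> real) \<Rightarrow> 'a \<Rightarrow> real" where
  "game_payoff M F L U t T \<Gamma> \<sigma> \<tau> = real_cond_exp M (F t) (game_reward L U T \<Gamma> \<sigma> \<tau>)"

text \<open>The number \<open>v\<close> is the common value of the upper and the lower value at time \<open>0\<close>.\<close>

definition game_value ::
    "'a measure \<Rightarrow> (real \<Rightarrow> 'a measure) \<Rightarrow> (real \<Rightarrow> 'a \<Rightarrow> real) \<Rightarrow> (real \<Rightarrow> 'a \<Rightarrow> real) \<Rightarrow>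
     real \<Rightarrow> ('a \<Rightarrow> real) \<Rightarrow> real \<Rightarrow> bool" where
  "game_value M F L U T \<Gamma> v \<longleftrightarrow>
     (let \<T> = stopping_times M F 0 T; D = (\<lambda>\<sigma> \<tau> \<omega>. ereal (game_payoff M F L U 0 T \<Gamma> \<sigma> \<tau> \<omega>)) in
       (AE \<omega> in M. ess_INF M \<T> (\<lambda>\<sigma>. ess_SUP M \<T> (\<lambda>\<tau>. D \<sigma> \<tau>)) \<omega> = ereal v) \<and>
       (AE \<omega> in M. ess_SUP M \<T> (\<lambda>\<tau>. ess_INF M \<T> (\<lambda>\<sigma>. D \<sigma> \<tau>)) \<omega> = ereal v))"

locale dynkin_setting = prob_space M + complete_measure M
  for M :: "'a measure" +
  fixes B :: "real \<Rightarrow> 'a \<Rightarrow> real"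
    and gamma_minus gamma_plus :: "real \<Rightarrow> 'a \<Rightarrow> real"
  assumes brownian: "standard_brownian_motion M B"
    and sets_M: "sets M = sigma_sets (space M) (\<Union>t\<in>{0..}. sets (completed_filtration M B t))"
    and gamma_minus: "gamma_minus \<in> process_S2 M (completed_filtration M B)
                        \<inter> process_Q M (completed_filtration M B)"
    and gamma_plus: "gamma_plus \<in> process_S2 M (completed_filtration M B)
                        \<inter> process_Q M (completed_filtration M B)"
    and gamma_pos: "\<And>t. 0 \<le> t \<Longrightarrow> AE \<omega> in M. gamma_minus t \<omega> + gamma_plus t \<omega> > 0"

section \<open>Sequences of terminal values\<close>

definition admissible_sequence ::
    "'a measure \<Rightarrow> (real \<Rightarrow> 'a measure) \<Rightarrow> (real \<Rightarrow> 'a \<Rightarrow> real) \<Rightarrow> (real \<Rightarrow> 'a \<Rightarrow> real) \<Rightarrow>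
     (nat \<Rightarrow> real) \<Rightarrow> (nat \<Rightarrow> 'a \<Rightarrow> real) \<Rightarrow> ('a \<Rightarrow> real) \<Rightarrow> bool" where
  "admissible_sequence M F L U Tn \<Gamma>n \<Gamma> \<longleftrightarrow>
     (\<forall>n. \<Gamma>n n \<in> borel_measurable (F (Tn n))) \<and>
     (\<forall>n. AE \<omega> in M. L (Tn n) \<omega> \<le> \<Gamma>n n \<omega> \<and> \<Gamma>n n \<omega> \<le> U (Tn n) \<omega>) \<and>
     (AE \<omega> in M. (\<lambda>n. \<Gamma>n n \<omega>) \<longlonglongrightarrow> \<Gamma> \<omega>) \<and>
     (\<integral>\<^sup>+ \<omega>. (SUP n. ennreal \<bar>\<Gamma>n n \<omega>\<bar>)\<^sup>2 \<partial>M) < \<infinity>"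

definition decreases_to :: "(nat \<Rightarrow> real) \<Rightarrow> real \<Rightarrow> bool" where
  "decreases_to Tn T \<longleftrightarrow> (\<forall>n. 0 < Tn n) \<and> decseq Tn \<and> Tn \<longlonglongrightarrow> T"

end

theory Submission
  imports Defs
begin

text \<open>
  A strategy for the horizon \<open>T\<close> extends to a horizon \<open>T' \<ge> T\<close> by waiting until \<open>T'\<close> whenever
  it would have waited until \<open>T\<close>; conversely every strategy for \<open>T'\<close> can be cut off at \<open>T\<close>. If the
  minimiser plays an extended \<open>\<sigma>\<close> and the maximiser an arbitrary \<open>\<tau>\<close>, the reward exceeds the reward
  of \<open>\<sigma>\<close> against the cut off \<open>\<tau>\<close> only if \<open>\<sigma> = T \<le> \<tau>\<close>, and because of \<open>L T \<le> \<Gamma>\<close> then by at most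
  \<open>\<bar>L \<tau> - L T\<bar> + \<bar>\<Gamma>' - \<Gamma>\<bar>\<close>. As \<open>T'\<close> decreases to \<open>T\<close> the expectation of this error tends to
  \<open>0\<close> by right-continuity of the barrier and dominated convergence. The maximiser is treated in the
  same way, with \<open>U\<close> in place of \<open>L\<close>. Conditional expectations and essential extrema reduce to
  expectations and ordinary extrema because the initial sigma-algebra is trivial.
\<close>

section \<open>Essential extrema of almost surely constant families\<close>

text \<open>Each version is a measurable upper bound for the family and the other is least among
  these. Applied in both directions, this identifies the version chosen by \<open>SOME\<close>
  almost surely.\<close>

lemma is_ess_sup_le:
  assumes Z: "is_ess_sup M I X Z" and Y: "is_ess_sup M I X Y"
  shows "AE \<omega> in M. Z \<omega> \<le> Y \<omega>"
proof -
  have "\<forall>Y\<in>borel_measurable M. (\<forall>i\<in>I. AE \<omega> in M. X i \<omega> \<le> Y \<omega>) \<longrightarrow> (AE \<omega> in M. Z \<omega> \<le> Y \<omega>)"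
    using Z unfolding is_ess_sup_def by (elim conjE)
  moreover have "Y \<in> borel_measurable M" "\<forall>i\<in>I. AE \<omega> in M. X i \<omega> \<le> Y \<omega>"
    using Y unfolding is_ess_sup_def by - (elim conjE; assumption)+
  ultimately show ?thesis by simp
qed

lemma is_ess_inf_le:
  assumes Z: "is_ess_inf M I X Z" and Y: "is_ess_inf M I X Y"
  shows "AE \<omega> in M. Z \<omega> \<le> Y \<omega>"
proof -
  have "\<forall>Z\<in>borel_measurable M. (\<forall>i\<in>I. AE \<omega> in M. Z \<omega> \<le> X i \<omega>) \<longrightarrow> (AE \<omega> in M. Z \<omega> \<le> Y \<omega>)"
    using Y unfolding is_ess_inf_def by (elim conjE)
  moreover have "Z \<in> borel_measurable M" "\<forall>i\<in>I. AE \<omega> in M. Z \<omega> \<le> X i \<omega>"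
    using Z unfolding is_ess_inf_def by - (elim conjE; assumption)+
  ultimately show ?thesis by simp
qed

context prob_space
begin

text \<open>The index set may be uncountable, so the exceptional null sets cannot be united over
  \<open>I\<close>. The supremum of the constants is however that of a sequence drawn from them, and
  countably many null sets can be united.\<close>

lemma ess_SUP_AE_const:
  fixes c :: "'i \<Rightarrow> ereal"
  assumes X: "\<And>i. i \<in> I \<Longrightarrow> AE \<omega> in M. X i \<omega> = c i"
  shows "AE \<omega> in M. ess_SUP M I X \<omega> = (SUP i\<in>I. c i)"
proof -
  have sup: "is_ess_sup M I X (\<lambda>_. SUP i\<in>I. c i)"
    unfolding is_ess_sup_def
  proof (intro conjI ballI impI)
    fix i assume i: "i \<in> I"
    show "AE \<omega> in M. X i \<omega> \<le> (SUP i\<in>I. c i)"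
      using X[OF i] by eventually_elim (simp add: SUP_upper i)
  next
    fix Y :: "'a \<Rightarrow> ereal"
    assume Y: "\<forall>i\<in>I. AE \<omega> in M. X i \<omega> \<le> Y \<omega>"
    show "AE \<omega> in M. (SUP i\<in>I. c i) \<le> Y \<omega>"
    \<comment> \<open>For empty \<open>I\<close> the supremum is \<open>-\<infinity>\<close> and the
      bound is trivial; a sequence of values of \<open>c\<close> exists only in the other
      case.\<close>
    proof (cases "I = {}")
      case False
      then obtain f :: "nat \<Rightarrow> ereal"
        where f: "range f \<subseteq> c ` I" "(SUP i\<in>I. c i) = (SUP n. f n)"
        using Sup_countable_SUP[of "c ` I"] by auto
      have "AE \<omega> in M. f n \<le> Y \<omega>" for n
      proof -
        obtain i where i: "i \<in> I" "f n = c i" using f(1) by auto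
        from X[OF i(1)] Y[rule_format, OF i(1)] show ?thesis
          by eventually_elim (simp add: i)
      qed
      then have "AE \<omega> in M. \<forall>n. f n \<le> Y \<omega>" by (simp add: AE_all_countable)
      then show ?thesis
        by eventually_elim (simp add: f(2) SUP_least)
    qed (simp add: bot_ereal_def)
  qed simp
  \<comment> \<open>The constant witnesses that an essential supremum exists, so the choice in
    \<open>ess_SUP\<close> does return one.\<close>
  then have "is_ess_sup M I X (ess_SUP M I X)"
    unfolding ess_SUP_def by (rule someI[of "is_ess_sup M I X"])
  from is_ess_sup_le[OF this sup] is_ess_sup_le[OF sup this]
  show ?thesis by eventually_elim simp
qed

text \<open>Dual argument, with a sequence of values of \<open>c\<close> that has the same
  infimum.\<close>

lemma ess_INF_AE_const:
  fixes c :: "'i \<Rightarrow> ereal"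
  assumes X: "\<And>i. i \<in> I \<Longrightarrow> AE \<omega> in M. X i \<omega> = c i"
  shows "AE \<omega> in M. ess_INF M I X \<omega> = (INF i\<in>I. c i)"
proof -
  have inf: "is_ess_inf M I X (\<lambda>_. INF i\<in>I. c i)"
    unfolding is_ess_inf_def
  proof (intro conjI ballI impI)
    fix i assume i: "i \<in> I"
    show "AE \<omega> in M. (INF i\<in>I. c i) \<le> X i \<omega>"
      using X[OF i] by eventually_elim (simp add: INF_lower i)
  next
    fix Y :: "'a \<Rightarrow> ereal"
    assume Y: "\<forall>i\<in>I. AE \<omega> in M. Y \<omega> \<le> X i \<omega>"
    show "AE \<omega> in M. Y \<omega> \<le> (INF i\<in>I. c i)"
    proof (cases "I = {}")
      case False
      then obtain f :: "nat \<Rightarrow> ereal"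
        where f: "range f \<subseteq> c ` I" "(INF i\<in>I. c i) = (INF n. f n)"
        using Inf_countable_INF[of "c ` I"] by auto
      have "AE \<omega> in M. Y \<omega> \<le> f n" for n
      proof -
        obtain i where i: "i \<in> I" "f n = c i" using f(1) by auto
        from X[OF i(1)] Y[rule_format, OF i(1)] show ?thesis
          by eventually_elim (simp add: i)
      qed
      then have "AE \<omega> in M. \<forall>n. Y \<omega> \<le> f n" by (simp add: AE_all_countable)
      then show ?thesis
        by eventually_elim (simp add: f(2) INF_greatest)
    qed (simp add: top_ereal_def)
  qed simp
  then have "is_ess_inf M I X (ess_INF M I X)"
    unfolding ess_INF_def by (rule someI[of "is_ess_inf M I X"])
  from is_ess_inf_le[OF this inf] is_ess_inf_le[OF inf this]
  show ?thesis by eventually_elim simp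
qed

section \<open>Integrable envelopes and completeness\<close>

text \<open>Since \<open>y \<le> 1 + y\<^sup>2\<close> and the total mass is 1, a finite second
  moment gives a finite first moment, hence almost sure finiteness. This turns suprema in
  \<open>ennreal\<close> into real dominating functions.\<close>

lemma integrable_square_envelope:
  fixes Y :: "'a \<Rightarrow> ennreal"
  assumes [measurable]: "Y \<in> borel_measurable M" and fin: "(\<integral>\<^sup>+ \<omega>. (Y \<omega>)\<^sup>2 \<partial>M) < \<infinity>"
  shows "integrable M (\<lambda>\<omega>. enn2real (Y \<omega>))" "AE \<omega> in M. Y \<omega> = ennreal (enn2real (Y \<omega>))"
proof -
  have "y \<le> 1 + y\<^sup>2" for y :: ennreal
  proof (cases "y \<le> 1")
    case True
    then show ?thesis by (rule order_trans) simp
  next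
    case False
    then have "y * 1 \<le> y * y" by (intro mult_left_mono) auto
    then show ?thesis by (simp add: power2_eq_square add_increasing)
  qed
  then have "(\<integral>\<^sup>+ \<omega>. Y \<omega> \<partial>M) \<le> (\<integral>\<^sup>+ \<omega>. 1 + (Y \<omega>)\<^sup>2 \<partial>M)"
    by (intro nn_integral_mono) simp
  also have "\<dots> = 1 + (\<integral>\<^sup>+ \<omega>. (Y \<omega>)\<^sup>2 \<partial>M)"
    by (subst nn_integral_add) (auto simp: emeasure_space_1)
  also have "\<dots> < \<infinity>" using fin by (simp add: ennreal_add_less_top)
  finally have Y: "(\<integral>\<^sup>+ \<omega>. Y \<omega> \<partial>M) < \<infinity>" .
  then have "AE \<omega> in M. Y \<omega> \<noteq> \<infinity>" by (intro nn_integral_noteq_infinite) auto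
  then show eq: "AE \<omega> in M. Y \<omega> = ennreal (enn2real (Y \<omega>))"
    by eventually_elim (simp add: less_top)
  have "(\<integral>\<^sup>+ \<omega>. ennreal (enn2real (Y \<omega>)) \<partial>M) = (\<integral>\<^sup>+ \<omega>. Y \<omega> \<partial>M)"
    using eq by (intro nn_integral_cong_AE) auto
  with Y show "integrable M (\<lambda>\<omega>. enn2real (Y \<omega>))"
    by (intro integrableI_bounded) auto
qed

end

text \<open>Preimages under the two functions differ only inside a null set, and completeness makes
  every subset of a null set measurable.\<close>

lemma (in complete_measure) borel_measurable_AE_eq:
  fixes f g :: "'a \<Rightarrow> 'b::topological_space"
  assumes f: "f \<in> borel_measurable M" and eq: "AE x in M. f x = g x"
  shows "g \<in> borel_measurable M"
proof (rule measurableI)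
  fix A :: "'b set" assume A: "A \<in> sets borel"
  show "g -` A \<inter> space M \<in> sets M"
  proof (rule in_sets_AE)
    show "AE x in M. (x \<in> f -` A \<inter> space M) = (x \<in> g -` A \<inter> space M)"
      using eq by eventually_elim auto
    show "f -` A \<inter> space M \<in> sets M" using f A by (rule measurable_sets)
  qed auto
qed auto

section \<open>Comparison of rewards for two horizons\<close>

text \<open>The comparison is strict because \<open>\<nu> \<omega> = T\<close> means that the player
  never stopped early; this decision is carried over to \<open>T'\<close>.\<close>

definition extend_time :: "real \<Rightarrow> real \<Rightarrow> ('a \<Rightarrow> real) \<Rightarrow> 'a \<Rightarrow> real" where
  "extend_time T T' \<nu> \<omega> = (if \<nu> \<omega> < T then \<nu> \<omega> else T')"

text \<open>If \<open>\<sigma>\<close> or \<open>\<tau>\<close> lies before \<open>T\<close>, both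
  rewards coincide. Otherwise the short game pays \<open>\<Gamma>\<close>, while the long one pays
  \<open>L\<close> at \<open>\<tau>\<close> if \<open>\<tau> < T'\<close> and
  \<open>\<Gamma>'\<close> if \<open>\<tau> = T'\<close>; in the former case
  \<open>L T \<le> \<Gamma>\<close> leaves only the increment of \<open>L\<close>.\<close>

lemma game_reward_extend_minimiser:
  assumes "T \<le> T'" "\<sigma> \<omega> \<le> T" "\<tau> \<omega> \<le> T'" "L T \<omega> \<le> \<Gamma> \<omega>"
  shows "game_reward L U T' \<Gamma>' (extend_time T T' \<sigma>) \<tau> \<omega>
    \<le> game_reward L U T \<Gamma> \<sigma> (\<lambda>\<omega>. min (\<tau> \<omega>) T) \<omega>
      + (\<bar>L (max T (\<tau> \<omega>)) \<omega> - L T \<omega>\<bar> + \<bar>\<Gamma>' \<omega> - \<Gamma> \<omega>\<bar>)"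
  using assms unfolding game_reward_def extend_time_def
  by (cases "\<sigma> \<omega> < T"; cases "\<tau> \<omega> < T"; cases "\<tau> \<omega> < T'"; cases "\<sigma> \<omega> \<le> \<tau> \<omega>")
     (auto simp: min_def max_def)

text \<open>Mirror image: the rewards can differ only if \<open>\<tau> = T \<le> \<sigma>\<close>.
  Then the long game pays \<open>U\<close> at \<open>\<sigma>\<close> or \<open>\<Gamma>'\<close>,
  and \<open>\<Gamma> \<le> U T\<close> bounds the loss.\<close>

lemma game_reward_extend_maximiser:
  assumes "T \<le> T'" "\<sigma> \<omega> \<le> T'" "\<tau> \<omega> \<le> T" "\<Gamma> \<omega> \<le> U T \<omega>"
  shows "game_reward L U T \<Gamma> (\<lambda>\<omega>. min (\<sigma> \<omega>) T) \<tau> \<omega>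
    \<le> game_reward L U T' \<Gamma>' \<sigma> (extend_time T T' \<tau>) \<omega>
      + (\<bar>U (max T (\<sigma> \<omega>)) \<omega> - U T \<omega>\<bar> + \<bar>\<Gamma>' \<omega> - \<Gamma> \<omega>\<bar>)"
  using assms unfolding game_reward_def extend_time_def
  by (cases "\<tau> \<omega> < T"; cases "\<sigma> \<omega> < T"; cases "\<sigma> \<omega> < T'"; cases "\<sigma> \<omega> \<le> \<tau> \<omega>")
     (auto simp: min_def max_def)

section \<open>Nearly optimal strategies\<close>

text \<open>Optimal strategies need not exist, so the value is accessed up to \<open>e\<close>: the
  first claim gives a nearly optimal minimiser, the second a good reply to any given minimiser. Both
  are stated over the reals to allow linear arithmetic.\<close>

lemma INF_SUP_ereal_near:
  fixes J :: "'i \<Rightarrow> 'j \<Rightarrow> real"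
  assumes v: "(INF i\<in>I. SUP j\<in>K. ereal (J i j)) = ereal v" and "0 < e"
  shows "\<exists>i\<in>I. \<forall>j\<in>K. J i j \<le> v + e" "\<And>i. i \<in> I \<Longrightarrow> \<exists>j\<in>K. v - e \<le> J i j"
proof -
  have "(INF i\<in>I. SUP j\<in>K. ereal (J i j)) < ereal (v + e)" using assms by simp
  then obtain i where i: "i \<in> I" "(SUP j\<in>K. ereal (J i j)) < ereal (v + e)"
    by (auto simp: INF_less_iff)
  have "J i j \<le> v + e" if "j \<in> K" for j
    using SUP_upper[OF that, of "\<lambda>j. ereal (J i j)"] i(2)
    by (metis ereal_less_eq(3) less_imp_le order_trans)
  with i(1) show "\<exists>i\<in>I. \<forall>j\<in>K. J i j \<le> v + e" by blast
next
  fix i assume i: "i \<in> I"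
  have "ereal (v - e) < ereal v" using \<open>0 < e\<close> by simp
  also have "\<dots> \<le> (SUP j\<in>K. ereal (J i j))" unfolding v[symmetric] by (rule INF_lower[OF i])
  finally show "\<exists>j\<in>K. v - e \<le> J i j" by (auto simp: less_SUP_iff intro: less_imp_le)
qed

lemma SUP_INF_ereal_near:
  fixes J :: "'i \<Rightarrow> 'j \<Rightarrow> real"
  assumes v: "(SUP j\<in>K. INF i\<in>I. ereal (J i j)) = ereal v" and "0 < e"
  shows "\<exists>j\<in>K. \<forall>i\<in>I. v - e \<le> J i j" "\<And>j. j \<in> K \<Longrightarrow> \<exists>i\<in>I. J i j \<le> v + e"
proof -
  have "ereal (v - e) < (SUP j\<in>K. INF i\<in>I. ereal (J i j))" using assms by simp
  then obtain j where j: "j \<in> K" "ereal (v - e) < (INF i\<in>I. ereal (J i j))"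
    by (auto simp: less_SUP_iff)
  have "v - e \<le> J i j" if "i \<in> I" for i
    using INF_lower[OF that, of "\<lambda>i. ereal (J i j)"] j(2)
    by (metis ereal_less_eq(3) less_imp_le order_trans)
  with j(1) show "\<exists>j\<in>K. \<forall>i\<in>I. v - e \<le> J i j" by blast
next
  fix j assume j: "j \<in> K"
  have "(INF i\<in>I. ereal (J i j)) \<le> ereal v" unfolding v[symmetric] by (rule SUP_upper[OF j])
  also have "ereal v < ereal (v + e)" using \<open>0 < e\<close> by simp
  finally show "\<exists>i\<in>I. J i j \<le> v + e" by (auto simp: INF_less_iff intro: less_imp_le)
qed

section \<open>The completed Brownian filtration\<close>

context dynkin_setting
begin

abbreviation F :: "real \<Rightarrow> 'a measure" where
  "F \<equiv> completed_filtration M B"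

lemma space_F: "space (F t) = space M"
  by (simp add: completed_filtration_def space_measure_of_conv)

lemma sets_F:
  "sets (F t) = sigma_sets (space M)
     ({B s -` A \<inter> space M | s A. 0 \<le> s \<and> s \<le> t \<and> A \<in> sets borel} \<union> null_sets M)"
  unfolding completed_filtration_def
  by (rule sets_measure_of) (auto dest: sets.sets_into_space)

lemma filtration_F: "filtration (space M) F"
proof
  fix s t :: real assume st: "s \<le> t"
  let ?G = "\<lambda>t. {B u -` A \<inter> space M | u A. 0 \<le> u \<and> u \<le> t \<and> A \<in> sets borel}"
  have "?G s \<subseteq> ?G t"
  proof (intro Collect_mono impI, elim exE conjE)
    fix X u A assume "X = B u -` A \<inter> space M" "0 \<le> u" "u \<le> s" "A \<in> sets borel"
    then show "\<exists>u A. X = B u -` A \<inter> space M \<and> 0 \<le> u \<and> u \<le> t \<and> A \<in> sets borel"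
      using st by (intro exI[of _ u] exI[of _ A]) simp
  qed
  then show "sets (F s) \<subseteq> sets (F t)"
    unfolding sets_F by (intro sigma_sets_mono' Un_mono subset_refl)
qed (rule space_F)

lemma sets_F_subset: "sets (F t) \<subseteq> sets M"
proof -
  \<comment> \<open>\<open>sets_M\<close> is generated by nonnegative times only; a negative
    \<open>t\<close> is covered by monotonicity.\<close>
  have "sets (F t) \<subseteq> sets (F (max 0 t))"
    by (rule filtration.sets_F_mono[OF filtration_F]) simp
  also have "\<dots> \<subseteq> sets M" unfolding sets_M by (intro subsetI sigma_sets.Basic) auto
  finally show ?thesis .
qed

lemma subalgebra_F: "subalgebra M (F t)"
  by (simp add: subalgebra_def space_F sets_F_subset)

lemma stopping_time_measurable: "stopping_time F \<nu> \<Longrightarrow> \<nu> \<in> borel_measurable M"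
  by (rule measurable_stopping_time[OF _ sets_F_subset space_F])

section \<open>Triviality of the initial sigma-algebra\<close>

text \<open>The generators at time 0 are null sets and events about \<open>B 0\<close>, which is
  almost surely 0. The zero-one alternative survives complements and countable unions.\<close>

lemma F_0_trivial:
  assumes "A \<in> sets (F 0)"
  shows "(AE \<omega> in M. \<omega> \<in> A) \<or> (AE \<omega> in M. \<omega> \<notin> A)"
  using assms unfolding sets_F
proof induction
  case (Basic A)
  show ?case
  proof (cases "A \<in> null_sets M")
    case True
    then show ?thesis by (simp add: AE_not_in)
  next
    case False
    then obtain C where C: "A = B 0 -` C \<inter> space M" using Basic by force
    have "AE \<omega> in M. B 0 \<omega> = 0" using brownian by (simp add: standard_brownian_motion_def)
    then have "AE \<omega> in M. \<omega> \<in> A \<longleftrightarrow> 0 \<in> C" using AE_space by eventually_elim (simp add: C)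
    then show ?thesis by (cases "0 \<in> C") auto
  qed
next
  case (Compl A)
  then show ?case by (auto elim!: AE_mp)
next
  case (Union A)
  then show ?case
  proof (cases "\<exists>i. AE \<omega> in M. \<omega> \<in> A i")
    case True
    then show ?thesis by (auto elim: AE_mp)
  next
    case False
    with Union have "AE \<omega> in M. \<forall>i. \<omega> \<notin> A i" by (auto simp: AE_all_countable)
    then show ?thesis by simp
  qed
qed simp

text \<open>A set of \<open>F 0\<close> has probability 0 or 1, so the integrals of \<open>f\<close>
  and of its mean over it agree: both vanish or both are the full expectation.\<close>

lemma real_cond_exp_F_0:
  assumes f: "integrable M f"
  shows "AE \<omega> in M. real_cond_exp M (F 0) f \<omega> = expectation f"
proof -
  interpret G: finite_measure_subalgebra M "F 0"
    by unfold_locales (rule subalgebra_F)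
  show ?thesis
  proof (rule G.real_cond_exp_charact)
    fix A assume A: "A \<in> sets (F 0)"
    then have AM [measurable]: "A \<in> sets M" using sets_F_subset by auto
    have fm [measurable]: "f \<in> borel_measurable M" using f by simp
    show "(\<integral>x\<in>A. f x \<partial>M) = (\<integral>x\<in>A. expectation f \<partial>M)"
      using F_0_trivial[OF A]
    proof
      assume AE: "AE \<omega> in M. \<omega> \<in> A"
      have "(\<integral>x\<in>A. g x \<partial>M) = (\<integral>x. g x \<partial>M)" if [measurable]: "g \<in> borel_measurable M" for g :: "'a \<Rightarrow> real"
        unfolding set_lebesgue_integral_def
        by (rule integral_cong_AE) (use AE in auto)
      from this[of f] this[of "\<lambda>_. expectation f"] show ?thesis by (simp add: prob_space)
    next
      assume AE: "AE \<omega> in M. \<omega> \<notin> A"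
      have "(\<integral>x\<in>A. g x \<partial>M) = (\<integral>x. 0 \<partial>M)" if [measurable]: "g \<in> borel_measurable M" for g :: "'a \<Rightarrow> real"
        unfolding set_lebesgue_integral_def
        by (rule integral_cong_AE) (use AE in auto)
      from this[of f] this[of "\<lambda>_. expectation f"] show ?thesis by simp
    qed
  qed (use f in auto)
qed

section \<open>Cutting off and extending stopping times\<close>

lemma stopping_times_D:
  assumes "\<nu> \<in> stopping_times M F 0 T"
  shows "\<nu> \<in> borel_measurable M" "AE \<omega> in M. 0 \<le> \<nu> \<omega> \<and> \<nu> \<omega> \<le> T"
  using assms by (auto simp: stopping_times_def stopping_time_measurable)

lemma stopping_times_min:
  assumes "\<nu> \<in> stopping_times M F 0 T'" "0 \<le> T"
  shows "(\<lambda>\<omega>. min (\<nu> \<omega>) T) \<in> stopping_times M F 0 T"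
proof -
  have "AE \<omega> in M. 0 \<le> min (\<nu> \<omega>) T \<and> min (\<nu> \<omega>) T \<le> T"
    using stopping_times_D(2)[OF assms(1)] by eventually_elim (use assms(2) in auto)
  then show ?thesis
    using assms(1) by (auto simp: stopping_times_def intro!: stopping_time_min stopping_time_const)
qed

text \<open>Before \<open>T\<close> the extended time has stopped exactly when \<open>\<nu>\<close>
  has. From \<open>T\<close> on, it is already known whether \<open>\<nu> < T\<close>, and this
  decides whether the player waits until the deterministic time \<open>T'\<close>.\<close>

lemma stopping_times_extend:
  assumes \<nu>: "\<nu> \<in> stopping_times M F 0 T" and T: "0 \<le> T" "T \<le> T'"
  shows "extend_time T T' \<nu> \<in> stopping_times M F 0 T'"
proof -
  interpret filtration "space M" F by (rule filtration_F)
  have st: "stopping_time F \<nu>" using \<nu> by (simp add: stopping_times_def)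
  have "stopping_time F (extend_time T T' \<nu>)"
  proof
    fix t
    show "Measurable.pred (F t) (\<lambda>\<omega>. extend_time T T' \<nu> \<omega> \<le> t)"
    proof (cases "t < T")
      case True
      then have "(\<lambda>\<omega>. extend_time T T' \<nu> \<omega> \<le> t) = (\<lambda>\<omega>. \<nu> \<omega> \<le> t)"
        using T by (auto simp: extend_time_def fun_eq_iff)
      then show ?thesis using stopping_timeD[OF st, of t] by simp
    next
      case False
      then have eq: "(\<lambda>\<omega>. extend_time T T' \<nu> \<omega> \<le> t) = (\<lambda>\<omega>. \<nu> \<omega> < T \<or> T' \<le> t)"
        by (auto simp: extend_time_def fun_eq_iff)
      have [measurable]: "Measurable.pred (F t) (\<lambda>\<omega>. \<nu> \<omega> < T)"
        using stopping_time_less_const[OF st, of T] sets_F_mono[of T t] False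
        by (auto simp: pred_def space_F)
      show ?thesis unfolding eq by measurable
    qed
  qed
  moreover have "AE \<omega> in M. 0 \<le> extend_time T T' \<nu> \<omega> \<and> extend_time T T' \<nu> \<omega> \<le> T'"
    using stopping_times_D(2)[OF \<nu>] by eventually_elim (use T in \<open>auto simp: extend_time_def\<close>)
  ultimately show ?thesis by (simp add: stopping_times_def)
qed

section \<open>The barriers along random times\<close>

lemma process_measurable:
  assumes "X \<in> process_Q M F" "0 \<le> t"
  shows "X t \<in> borel_measurable M"
  using assms measurable_from_subalg[OF subalgebra_F, of "X t" t]
  by (auto simp: process_Q_def adapted_def)

lemma process_right_continuous:
  assumes "X \<in> process_Q M F"
  shows "AE \<omega> in M. \<forall>t\<ge>0. continuous (at_right t) (\<lambda>t. X t \<omega>)"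
proof -
  have "AE \<omega> in M. cadlag (\<lambda>t. X t \<omega>)" using assms by (simp add: process_Q_def)
  then show ?thesis by eventually_elim (simp add: cadlag_def)
qed

text \<open>
  The supremum defining \<^const>\<open>process_S2\<close> ranges over uncountably many times and its measurability
  is not given, so its integral is only a lower integral. Right-continuity reduces it to the
  supremum over rational times.
\<close>

lemma process_dominated:
  assumes S2: "X \<in> process_S2 M F" and Q: "X \<in> process_Q M F"
  obtains Y where "integrable M Y" "AE \<omega> in M. \<forall>t\<ge>0. \<bar>X t \<omega>\<bar> \<le> Y \<omega>"
proof
  define R :: "real set" where "R = \<rat> \<inter> {0..}"
  have R: "countable R" by (simp add: R_def countable_rat)
  define Z where "Z \<omega> = (SUP t\<in>R. ennreal \<bar>X t \<omega>\<bar>)" for \<omega>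
  have [measurable]: "Z \<in> borel_measurable M"
    unfolding Z_def
  proof (rule borel_measurable_SUP[OF R])
    fix t assume "t \<in> R"
    then have [measurable]: "X t \<in> borel_measurable M"
      by (intro process_measurable[OF Q]) (simp add: R_def)
    show "(\<lambda>\<omega>. ennreal \<bar>X t \<omega>\<bar>) \<in> borel_measurable M" by measurable
  qed
  \<comment> \<open>Monotonicity holds for the lower integral as well, so the measurability of the
    right-hand integrand is not at issue.\<close>
  have "(\<integral>\<^sup>+ \<omega>. (Z \<omega>)\<^sup>2 \<partial>M) \<le> (\<integral>\<^sup>+ \<omega>. (SUP t\<in>{0..}. ennreal \<bar>X t \<omega>\<bar>)\<^sup>2 \<partial>M)"
    by (intro nn_integral_mono power_mono) (auto simp: Z_def R_def intro!: SUP_subset_mono)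
  also have "\<dots> < \<infinity>" using S2 by (simp add: process_S2_def)
  finally have Z: "(\<integral>\<^sup>+ \<omega>. (Z \<omega>)\<^sup>2 \<partial>M) < \<infinity>" .
  show "integrable M (\<lambda>\<omega>. enn2real (Z \<omega>))"
    using Z by (intro integrable_square_envelope) auto
  have "AE \<omega> in M. Z \<omega> = ennreal (enn2real (Z \<omega>))"
    using Z by (intro integrable_square_envelope) auto
  with process_right_continuous[OF Q]
  show "AE \<omega> in M. \<forall>t\<ge>0. \<bar>X t \<omega>\<bar> \<le> enn2real (Z \<omega>)"
  proof eventually_elim
    case (elim \<omega>)
    have rat: "\<bar>X t \<omega>\<bar> \<le> enn2real (Z \<omega>)" if "t \<in> R" for t
    proof -
      have "ennreal \<bar>X t \<omega>\<bar> \<le> Z \<omega>" unfolding Z_def by (rule SUP_upper[OF that])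
      then show ?thesis using elim(2) by (metis ennreal_le_iff enn2real_nonneg)
    qed
    show ?case
    proof (intro allI impI)
      fix t :: real assume t: "0 \<le> t"
      have lim: "((\<lambda>s. \<bar>X s \<omega>\<bar>) \<longlongrightarrow> \<bar>X t \<omega>\<bar>) (at_right t)"
        using elim(1) t by (intro tendsto_rabs) (simp add: continuous_within)
      show "\<bar>X t \<omega>\<bar> \<le> enn2real (Z \<omega>)"
      \<comment> \<open>An excess over the envelope at \<open>t\<close> would persist on an interval
        to the right of \<open>t\<close>, which contains a rational time.\<close>
      proof (rule ccontr)
        assume "\<not> \<bar>X t \<omega>\<bar> \<le> enn2real (Z \<omega>)"
        then have "\<forall>\<^sub>F s in at_right t. enn2real (Z \<omega>) < \<bar>X s \<omega>\<bar>"
          by (intro order_tendstoD(1)[OF lim]) simp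
        then obtain b where b: "t < b" "\<And>s. t < s \<Longrightarrow> s < b \<Longrightarrow> enn2real (Z \<omega>) < \<bar>X s \<omega>\<bar>"
          by (auto simp: eventually_at_right_field)
        obtain r where r: "r \<in> \<rat>" "t < r" "r < b" using Rats_dense_in_real[OF b(1)] by blast
        then have "r \<in> R" using t by (simp add: R_def)
        then show False using rat b(2)[OF r(2,3)] by fastforce
      qed
    qed
  qed
qed

text \<open>The process at a random time is the pairing of that time with the identity, followed by
  the map that progressive measurability makes jointly measurable.\<close>

lemma process_at_random_time_measurable:
  assumes X: "progressively_measurable F X" and [measurable]: "\<rho> \<in> borel_measurable M"
    and \<rho>: "AE \<omega> in M. 0 \<le> \<rho> \<omega> \<and> \<rho> \<omega> \<le> T" and T: "0 \<le> T"
  shows "(\<lambda>\<omega>. X (\<rho> \<omega>) \<omega>) \<in> borel_measurable M"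
proof -
  \<comment> \<open>Joint measurability is available on \<open>{0..T}\<close> only, so the time is
    clamped to have all its values there; completeness undoes this change on a null set.\<close>
  define \<rho>' where "\<rho>' \<omega> = max 0 (min (\<rho> \<omega>) T)" for \<omega>
  have [measurable]: "\<rho>' \<in> borel_measurable M" unfolding \<rho>'_def by measurable
  have "\<rho>' \<in> M \<rightarrow>\<^sub>M restrict_space borel {0..T}"
    by (rule measurable_restrict_space2) (use T in \<open>auto simp: \<rho>'_def\<close>)
  moreover have "(\<lambda>\<omega>. \<omega>) \<in> M \<rightarrow>\<^sub>M F T"
    using subalgebra_F by (intro measurableI) (auto simp: subalgebra_def Int_absorb2 sets.sets_into_space)
  ultimately have "(\<lambda>\<omega>. (\<rho>' \<omega>, \<omega>)) \<in> M \<rightarrow>\<^sub>M restrict_space borel {0..T} \<Otimes>\<^sub>M F T"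
    by (rule measurable_Pair)
  moreover have "(\<lambda>(s, \<omega>). X s \<omega>) \<in> borel_measurable (restrict_space borel {0..T} \<Otimes>\<^sub>M F T)"
    using X T by (simp add: progressively_measurable_def)
  ultimately have "(\<lambda>\<omega>. X (\<rho>' \<omega>) \<omega>) \<in> borel_measurable M"
    by (auto dest: measurable_compose)
  moreover have "AE \<omega> in M. X (\<rho>' \<omega>) \<omega> = X (\<rho> \<omega>) \<omega>"
    using \<rho> by eventually_elim (simp add: \<rho>'_def)
  ultimately show ?thesis by (rule borel_measurable_AE_eq)
qed

text \<open>Squeezed between \<open>T\<close> and \<open>Tn n\<close>, the random times tend to
  \<open>T\<close> from the right, so right-continuity gives almost sure convergence. Twice the
  envelope of the process dominates.\<close>

lemma process_at_random_times_tendsto: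
  assumes S2: "X \<in> process_S2 M F" and Q: "X \<in> process_Q M F"
    and T: "0 \<le> T" and Tn: "Tn \<longlonglongrightarrow> T"
    and m: "\<And>n. \<rho> n \<in> borel_measurable M"
    and \<rho>: "\<And>n. AE \<omega> in M. T \<le> \<rho> n \<omega> \<and> \<rho> n \<omega> \<le> Tn n"
  shows "integrable M (\<lambda>\<omega>. \<bar>X (\<rho> n \<omega>) \<omega> - X T \<omega>\<bar>)"
    "(\<lambda>n. expectation (\<lambda>\<omega>. \<bar>X (\<rho> n \<omega>) \<omega> - X T \<omega>\<bar>)) \<longlonglongrightarrow> 0"
proof -
  obtain Y where Y: "integrable M Y" "AE \<omega> in M. \<forall>t\<ge>0. \<bar>X t \<omega>\<bar> \<le> Y \<omega>"
    using process_dominated[OF S2 Q] .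
  have \<rho>': "AE \<omega> in M. 0 \<le> \<rho> n \<omega> \<and> \<rho> n \<omega> \<le> max 0 (Tn n)" for n
    using \<rho>[of n] by eventually_elim (use T in auto)
  have "progressively_measurable F X" using S2 by (simp add: process_S2_def)
  from process_at_random_time_measurable[OF this m \<rho>'] process_measurable[OF Q T]
  have meas: "(\<lambda>\<omega>. \<bar>X (\<rho> n \<omega>) \<omega> - X T \<omega>\<bar>) \<in> borel_measurable M" for n
    by (intro borel_measurable_abs borel_measurable_diff) auto
  have bound: "AE \<omega> in M. norm \<bar>X (\<rho> n \<omega>) \<omega> - X T \<omega>\<bar> \<le> 2 * Y \<omega>" for n
    using Y(2) \<rho>[of n]
  proof eventually_elim
    case (elim \<omega>)
    then have "\<bar>X (\<rho> n \<omega>) \<omega>\<bar> \<le> Y \<omega>" "\<bar>X T \<omega>\<bar> \<le> Y \<omega>" using T by auto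
    then show ?case by simp
  qed
  have "AE \<omega> in M. \<forall>n. T \<le> \<rho> n \<omega> \<and> \<rho> n \<omega> \<le> Tn n" using \<rho> by (simp add: AE_all_countable)
  with process_right_continuous[OF Q]
  have lim: "AE \<omega> in M. (\<lambda>n. \<bar>X (\<rho> n \<omega>) \<omega> - X T \<omega>\<bar>) \<longlonglongrightarrow> 0"
  proof eventually_elim
    case (elim \<omega>)
    have "(\<lambda>n. \<rho> n \<omega>) \<longlonglongrightarrow> T"
      by (rule tendsto_sandwich[OF _ _ tendsto_const Tn]) (use elim(2) in auto)
    \<comment> \<open>The random times may equal \<open>T\<close>, so continuity is used within the
      closed half-line.\<close>
    moreover have "continuous (at T within {T..}) (\<lambda>t. X t \<omega>)"
    proof -
      have "at T within {T..} = at_right T" by (rule at_within_Ici_at_right)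
      then show ?thesis using elim(1) T by simp
    qed
    ultimately have "(\<lambda>n. X (\<rho> n \<omega>) \<omega>) \<longlonglongrightarrow> X T \<omega>"
      using elim(2) by (auto simp: continuous_within_sequentially o_def)
    then show ?case by (simp add: LIM_zero_iff tendsto_rabs_zero_iff)
  qed
  have "integrable M (\<lambda>\<omega>. 2 * Y \<omega>)" using Y(1) by simp
  from integral_dominated_convergence[OF _ meas this lim bound]
  show "(\<lambda>n. expectation (\<lambda>\<omega>. \<bar>X (\<rho> n \<omega>) \<omega> - X T \<omega>\<bar>)) \<longlonglongrightarrow> 0" by simp
  show "integrable M (\<lambda>\<omega>. \<bar>X (\<rho> n \<omega>) \<omega> - X T \<omega>\<bar>)"
    by (rule Bochner_Integration.integrable_bound[OF \<open>integrable M (\<lambda>\<omega>. 2 * Y \<omega>)\<close> meas])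
       (use bound[of n] in eventually_elim, simp)
qed

section \<open>Game values as extrema of expected rewards\<close>

abbreviation L :: "real \<Rightarrow> 'a \<Rightarrow> real" where
  "L \<equiv> \<lambda>t \<omega>. - gamma_plus t \<omega>"

abbreviation U :: "real \<Rightarrow> 'a \<Rightarrow> real" where
  "U \<equiv> gamma_minus"

abbreviation expected_reward ::
    "real \<Rightarrow> ('a \<Rightarrow> real) \<Rightarrow> ('a \<Rightarrow> real) \<Rightarrow> ('a \<Rightarrow> real) \<Rightarrow> real" where
  "expected_reward T \<Gamma> \<sigma> \<tau> \<equiv> expectation (game_reward L U T \<Gamma> \<sigma> \<tau>)"

text \<open>The three indicator events are disjoint, so the sum of the envelopes of the barriers and
  \<open>\<bar>\<Gamma> \<omega>\<bar>\<close> dominates the reward.\<close>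

lemma game_reward_integrable:
  assumes T: "0 \<le> T" and \<Gamma>: "integrable M \<Gamma>"
    and \<sigma>: "\<sigma> \<in> stopping_times M F 0 T" and \<tau>: "\<tau> \<in> stopping_times M F 0 T"
  shows "integrable M (game_reward L U T \<Gamma> \<sigma> \<tau>)"
proof -
  obtain Y where Y: "integrable M Y" "AE \<omega> in M. \<forall>t\<ge>0. \<bar>gamma_minus t \<omega>\<bar> \<le> Y \<omega>"
    using process_dominated gamma_minus by blast
  obtain Z where Z: "integrable M Z" "AE \<omega> in M. \<forall>t\<ge>0. \<bar>gamma_plus t \<omega>\<bar> \<le> Z \<omega>"
    using process_dominated gamma_plus by blast
  note [measurable] = stopping_times_D(1)[OF \<sigma>] stopping_times_D(1)[OF \<tau>]
    borel_measurable_integrable[OF \<Gamma>]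
  have prog: "progressively_measurable F gamma_minus" "progressively_measurable F gamma_plus"
    using gamma_minus gamma_plus by (auto simp: process_S2_def)
  note [measurable] =
    process_at_random_time_measurable[OF prog(1) stopping_times_D[OF \<sigma>] T]
    process_at_random_time_measurable[OF prog(2) stopping_times_D[OF \<tau>] T]
  have meas: "game_reward L U T \<Gamma> \<sigma> \<tau> \<in> borel_measurable M"
    unfolding game_reward_def[abs_def] of_bool_def by measurable
  have "integrable M (\<lambda>\<omega>. Y \<omega> + Z \<omega> + \<bar>\<Gamma> \<omega>\<bar>)" using Y(1) Z(1) \<Gamma> by auto
  then show ?thesis
  proof (rule Bochner_Integration.integrable_bound[OF _ meas])
    show "AE \<omega> in M. norm (game_reward L U T \<Gamma> \<sigma> \<tau> \<omega>) \<le> norm (Y \<omega> + Z \<omega> + \<bar>\<Gamma> \<omega>\<bar>)"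
      using Y(2) Z(2) stopping_times_D(2)[OF \<sigma>] stopping_times_D(2)[OF \<tau>]
    proof eventually_elim
      case (elim \<omega>)
      then have "\<bar>U (\<sigma> \<omega>) \<omega>\<bar> \<le> Y \<omega>" "\<bar>gamma_plus (\<tau> \<omega>) \<omega>\<bar> \<le> Z \<omega>" by auto
      then show ?case by (auto simp: game_reward_def of_bool_def)
    qed
  qed
qed

lemma game_value_expected_reward:
  assumes T: "0 \<le> T" and \<Gamma>: "integrable M \<Gamma>" and v: "game_value M F L U T \<Gamma> v"
  defines "S \<equiv> stopping_times M F 0 T"
  shows "(INF \<sigma>\<in>S. SUP \<tau>\<in>S. ereal (expected_reward T \<Gamma> \<sigma> \<tau>)) = ereal v"
    "(SUP \<tau>\<in>S. INF \<sigma>\<in>S. ereal (expected_reward T \<Gamma> \<sigma> \<tau>)) = ereal v"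
proof -
  let ?D = "\<lambda>\<sigma> \<tau> \<omega>. ereal (game_payoff M F L U 0 T \<Gamma> \<sigma> \<tau> \<omega>)"
  have D: "AE \<omega> in M. ?D \<sigma> \<tau> \<omega> = ereal (expected_reward T \<Gamma> \<sigma> \<tau>)"
    if "\<sigma> \<in> S" "\<tau> \<in> S" for \<sigma> \<tau>
    using real_cond_exp_F_0[OF game_reward_integrable[OF T \<Gamma>]] that
    by (simp add: game_payoff_def S_def)
  have "AE \<omega> in M. ess_INF M S (\<lambda>\<sigma>. ess_SUP M S (\<lambda>\<tau>. ?D \<sigma> \<tau>)) \<omega>
      = (INF \<sigma>\<in>S. SUP \<tau>\<in>S. ereal (expected_reward T \<Gamma> \<sigma> \<tau>))"
    \<comment> \<open>The payoffs are almost surely constant, hence so are the inner essential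
      suprema, to which the outer lemma applies.\<close>
    by (intro ess_INF_AE_const ess_SUP_AE_const D)
  moreover have "AE \<omega> in M. ess_INF M S (\<lambda>\<sigma>. ess_SUP M S (\<lambda>\<tau>. ?D \<sigma> \<tau>)) \<omega> = ereal v"
    using v by (simp add: game_value_def Let_def S_def)
  ultimately have "AE \<omega> in M. (INF \<sigma>\<in>S. SUP \<tau>\<in>S. ereal (expected_reward T \<Gamma> \<sigma> \<tau>)) = ereal v"
    by eventually_elim simp
  \<comment> \<open>The equation does not involve \<open>\<omega>\<close>, so holding almost surely
    under a probability measure means that it is true.\<close>
  then show "(INF \<sigma>\<in>S. SUP \<tau>\<in>S. ereal (expected_reward T \<Gamma> \<sigma> \<tau>)) = ereal v" by simp
  have "AE \<omega> in M. ess_SUP M S (\<lambda>\<tau>. ess_INF M S (\<lambda>\<sigma>. ?D \<sigma> \<tau>)) \<omega>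
      = (SUP \<tau>\<in>S. INF \<sigma>\<in>S. ereal (expected_reward T \<Gamma> \<sigma> \<tau>))"
    by (intro ess_INF_AE_const ess_SUP_AE_const D)
  moreover have "AE \<omega> in M. ess_SUP M S (\<lambda>\<tau>. ess_INF M S (\<lambda>\<sigma>. ?D \<sigma> \<tau>)) \<omega> = ereal v"
    using v by (simp add: game_value_def Let_def S_def)
  ultimately have "AE \<omega> in M. (SUP \<tau>\<in>S. INF \<sigma>\<in>S. ereal (expected_reward T \<Gamma> \<sigma> \<tau>)) = ereal v"
    by eventually_elim simp
  then show "(SUP \<tau>\<in>S. INF \<sigma>\<in>S. ereal (expected_reward T \<Gamma> \<sigma> \<tau>)) = ereal v" by simp
qed

section \<open>Terminal values and their convergence in mean\<close>

lemma terminal_value_integrable: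
  assumes "terminal_value M F L' U' T \<Gamma>"
  shows "integrable M \<Gamma>"
proof (rule square_integrable_imp_integrable)
  show "\<Gamma> \<in> borel_measurable M"
    using assms by (intro measurable_from_subalg[OF subalgebra_F, of _ T]) (simp add: terminal_value_def)
  show "integrable M (\<lambda>\<omega>. (\<Gamma> \<omega>)\<^sup>2)" using assms by (simp add: terminal_value_def)
qed

lemma admissible_sequence_tendsto:
  assumes adm: "admissible_sequence M F L' U' Tn \<Gamma>n \<Gamma>" and \<Gamma>: "\<Gamma> \<in> borel_measurable M"
  shows "integrable M (\<Gamma>n n)" "(\<lambda>n. expectation (\<lambda>\<omega>. \<bar>\<Gamma>n n \<omega> - \<Gamma> \<omega>\<bar>)) \<longlonglongrightarrow> 0"
proof -
  note [measurable] = \<Gamma>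
  have meas [measurable]: "\<Gamma>n n \<in> borel_measurable M" for n
    using adm by (intro measurable_from_subalg[OF subalgebra_F, of _ "Tn n"])
      (simp add: admissible_sequence_def)
  have lim: "AE \<omega> in M. (\<lambda>n. \<Gamma>n n \<omega>) \<longlonglongrightarrow> \<Gamma> \<omega>" using adm by (simp add: admissible_sequence_def)
  define Z where "Z \<omega> = (SUP n. ennreal \<bar>\<Gamma>n n \<omega>\<bar>)" for \<omega>
  have [measurable]: "Z \<in> borel_measurable M" unfolding Z_def by measurable
  have "(\<integral>\<^sup>+ \<omega>. (Z \<omega>)\<^sup>2 \<partial>M) < \<infinity>" using adm by (simp add: admissible_sequence_def Z_def)
  then have Z: "integrable M (\<lambda>\<omega>. enn2real (Z \<omega>))" "AE \<omega> in M. Z \<omega> = ennreal (enn2real (Z \<omega>))"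
    by (auto intro!: integrable_square_envelope)
  have bound: "AE \<omega> in M. \<forall>n. \<bar>\<Gamma>n n \<omega>\<bar> \<le> enn2real (Z \<omega>)"
    using Z(2)
  proof eventually_elim
    case (elim \<omega>)
    have "ennreal \<bar>\<Gamma>n n \<omega>\<bar> \<le> Z \<omega>" for n unfolding Z_def by (rule SUP_upper) simp
    then show ?case using elim by (metis ennreal_le_iff enn2real_nonneg)
  qed
  show "integrable M (\<Gamma>n n)"
    by (rule Bochner_Integration.integrable_bound[OF Z(1) meas]) (use bound in eventually_elim, simp)
  have "(\<lambda>n. expectation (\<lambda>\<omega>. \<bar>\<Gamma>n n \<omega> - \<Gamma> \<omega>\<bar>)) \<longlonglongrightarrow> expectation (\<lambda>\<omega>. 0)"
  proof (rule integral_dominated_convergence)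
    show "integrable M (\<lambda>\<omega>. 2 * enn2real (Z \<omega>))" using Z(1) by simp
    show "AE \<omega> in M. (\<lambda>n. \<bar>\<Gamma>n n \<omega> - \<Gamma> \<omega>\<bar>) \<longlonglongrightarrow> 0"
      using lim by eventually_elim (simp add: LIM_zero tendsto_rabs_zero)
    show "AE \<omega> in M. norm \<bar>\<Gamma>n n \<omega> - \<Gamma> \<omega>\<bar> \<le> 2 * enn2real (Z \<omega>)" for n
      using bound lim
    proof eventually_elim
      case (elim \<omega>)
      \<comment> \<open>The envelope of the sequence also bounds its limit, whence the dominating
        function is twice the envelope.\<close>
      have "\<bar>\<Gamma> \<omega>\<bar> \<le> enn2real (Z \<omega>)"
        by (rule LIMSEQ_le_const2[OF tendsto_rabs[OF elim(2)]]) (use elim(1) in auto)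
      moreover have "\<bar>\<Gamma>n n \<omega>\<bar> \<le> enn2real (Z \<omega>)" using elim(1) by simp
      ultimately show ?case by simp
    qed
  qed measurable
  then show "(\<lambda>n. expectation (\<lambda>\<omega>. \<bar>\<Gamma>n n \<omega> - \<Gamma> \<omega>\<bar>)) \<longlonglongrightarrow> 0" by simp
qed

section \<open>Convergence of the values\<close>

text \<open>One strategy, nearly optimal for \<open>T\<close>, is fixed and extended to every
  \<open>Tn n\<close>; the opponent's replies vary with \<open>n\<close>. The error still vanishes
  because barrier increments tend to 0 in mean along any random times between \<open>T\<close> and
  \<open>Tn n\<close>.\<close>

lemma game_value_tendsto:
  assumes T: "0 < T" and dec: "decreases_to Tn T"
    and \<Gamma>: "terminal_value M F L U T \<Gamma>" and adm: "admissible_sequence M F L U Tn \<Gamma>n \<Gamma>"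
    and V: "game_value M F L U T \<Gamma> V" and Vn: "\<And>n. game_value M F L U (Tn n) (\<Gamma>n n) (Vn n)"
  shows "Vn \<longlonglongrightarrow> V"
proof -
  have lim: "Tn \<longlonglongrightarrow> T" and TTn: "\<And>n. T \<le> Tn n"
    using dec by (auto simp: decreases_to_def intro: decseq_ge)
  have T0: "0 \<le> T" "\<And>n. 0 \<le> Tn n" using T TTn by (auto intro: order_trans less_imp_le)
  have int: "integrable M \<Gamma>" "\<And>n. integrable M (\<Gamma>n n)"
    and \<Gamma>lim: "(\<lambda>n. expectation (\<lambda>\<omega>. \<bar>\<Gamma>n n \<omega> - \<Gamma> \<omega>\<bar>)) \<longlonglongrightarrow> 0"
    using terminal_value_integrable[OF \<Gamma>] admissible_sequence_tendsto[OF adm] by auto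
  have barrier: "AE \<omega> in M. L T \<omega> \<le> \<Gamma> \<omega> \<and> \<Gamma> \<omega> \<le> U T \<omega>"
    using \<Gamma> by (simp add: terminal_value_def)
  have err: "integrable M (\<lambda>\<omega>. \<bar>\<Gamma>n n \<omega> - \<Gamma> \<omega>\<bar>)" for n
    by (intro integrable_abs Bochner_Integration.integrable_diff int)
  let ?S = "stopping_times M F 0"
  \<comment> \<open>\<open>near(1)\<close> and \<open>near(3)\<close> provide a nearly optimal
    minimiser and maximiser; \<open>near(2)\<close> and \<open>near(4)\<close> provide replies to
    them.\<close>
  note near = INF_SUP_ereal_near[OF game_value_expected_reward(1)]
    SUP_INF_ereal_near[OF game_value_expected_reward(2)]
  have max: "(\<lambda>\<omega>. max T (\<nu> \<omega>)) \<in> borel_measurable M"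
    "AE \<omega> in M. T \<le> max T (\<nu> \<omega>) \<and> max T (\<nu> \<omega>) \<le> Tn n" if "\<nu> \<in> ?S (Tn n)" for n \<nu>
    using stopping_times_D[OF that] TTn[of n] by (auto elim!: AE_mp)
  have upper: "\<forall>\<^sub>F n in sequentially. Vn n < V + e" if e: "0 < e" for e
  proof -
    \<comment> \<open>One third each is spent on the suboptimality of \<open>\<sigma>\<close>, on
      that of the reply, and on the error term.\<close>
    define d where "d = e / 3"
    have d: "0 < d" using e by (simp add: d_def)
    obtain \<sigma> where \<sigma>: "\<sigma> \<in> ?S T" "\<And>\<tau>. \<tau> \<in> ?S T \<Longrightarrow> expected_reward T \<Gamma> \<sigma> \<tau> \<le> V + d"
      using near(1)[OF T0(1) int(1) V d] by blast
    have ext: "extend_time T (Tn n) \<sigma> \<in> ?S (Tn n)" for n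
      by (rule stopping_times_extend[OF \<sigma>(1) T0(1) TTn])
    have "\<exists>\<tau>\<in>?S (Tn n). Vn n - d \<le> expected_reward (Tn n) (\<Gamma>n n) (extend_time T (Tn n) \<sigma>) \<tau>" for n
      by (rule near(2)[OF T0(2) int(2) Vn d ext])
    then obtain \<tau> where \<tau>: "\<And>n. \<tau> n \<in> ?S (Tn n)"
      "\<And>n. Vn n - d \<le> expected_reward (Tn n) (\<Gamma>n n) (extend_time T (Tn n) \<sigma>) (\<tau> n)"
      by metis
    \<comment> \<open>This is the increment of \<open>L\<close>; the absolute value absorbs the
      sign, so the assumptions on \<open>gamma_plus\<close> apply directly.\<close>
    let ?X = "\<lambda>n \<omega>. \<bar>gamma_plus (max T (\<tau> n \<omega>)) \<omega> - gamma_plus T \<omega>\<bar>"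
    have X: "integrable M (?X n)" "(\<lambda>n. expectation (?X n)) \<longlonglongrightarrow> 0" for n
      using gamma_plus max[OF \<tau>(1)]
      by (auto intro!: process_at_random_times_tendsto[OF _ _ T0(1) lim])
    have bound: "Vn n \<le> V + 2 * d + (expectation (?X n) + expectation (\<lambda>\<omega>. \<bar>\<Gamma>n n \<omega> - \<Gamma> \<omega>\<bar>))" for n
    proof -
      note min = stopping_times_min[OF \<tau>(1)[of n] T0(1)]
      note i = game_reward_integrable[OF T0(1) int(1) \<sigma>(1) min]
      have "expected_reward (Tn n) (\<Gamma>n n) (extend_time T (Tn n) \<sigma>) (\<tau> n)
          \<le> expectation (\<lambda>\<omega>. game_reward L U T \<Gamma> \<sigma> (\<lambda>\<omega>. min (\<tau> n \<omega>) T) \<omega>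
              + (?X n \<omega> + \<bar>\<Gamma>n n \<omega> - \<Gamma> \<omega>\<bar>))"
      proof (rule integral_mono_AE)
        show "integrable M (game_reward L U (Tn n) (\<Gamma>n n) (extend_time T (Tn n) \<sigma>) (\<tau> n))"
          by (rule game_reward_integrable[OF T0(2) int(2) ext \<tau>(1)])
        show "integrable M (\<lambda>\<omega>. game_reward L U T \<Gamma> \<sigma> (\<lambda>\<omega>. min (\<tau> n \<omega>) T) \<omega>
            + (?X n \<omega> + \<bar>\<Gamma>n n \<omega> - \<Gamma> \<omega>\<bar>))"
          by (intro Bochner_Integration.integrable_add i X(1) err)
        show "AE \<omega> in M. game_reward L U (Tn n) (\<Gamma>n n) (extend_time T (Tn n) \<sigma>) (\<tau> n) \<omega>
            \<le> game_reward L U T \<Gamma> \<sigma> (\<lambda>\<omega>. min (\<tau> n \<omega>) T) \<omega> + (?X n \<omega> + \<bar>\<Gamma>n n \<omega> - \<Gamma> \<omega>\<bar>)"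
          using barrier stopping_times_D(2)[OF \<sigma>(1)] stopping_times_D(2)[OF \<tau>(1)[of n]]
        proof eventually_elim
          case (elim \<omega>)
          then show ?case
            using game_reward_extend_minimiser[of T "Tn n" \<sigma> \<omega> "\<tau> n" L \<Gamma> U "\<Gamma>n n"] TTn[of n]
            by (simp add: abs_minus_commute)
        qed
      qed
      also have "\<dots> = expected_reward T \<Gamma> \<sigma> (\<lambda>\<omega>. min (\<tau> n \<omega>) T)
          + (expectation (?X n) + expectation (\<lambda>\<omega>. \<bar>\<Gamma>n n \<omega> - \<Gamma> \<omega>\<bar>))"
        using i X(1) err by simp
      finally show ?thesis using \<tau>(2)[of n] \<sigma>(2)[OF min] by linarith
    qed
    have "\<forall>\<^sub>F n in sequentially. expectation (?X n) + expectation (\<lambda>\<omega>. \<bar>\<Gamma>n n \<omega> - \<Gamma> \<omega>\<bar>) < d"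
      using tendsto_add[OF X(2) \<Gamma>lim] d by (intro order_tendstoD) auto
    then show ?thesis
    proof eventually_elim
      case (elim n)
      then show ?case using bound[of n] by (simp add: d_def)
    qed
  qed
  \<comment> \<open>Roles are exchanged: the maximiser's strategy is extended, the minimiser's
    replies are cut off at \<open>T\<close>, and the error comes from \<open>U\<close>.\<close>
  have lower: "\<forall>\<^sub>F n in sequentially. V - e < Vn n" if e: "0 < e" for e
  proof -
    define d where "d = e / 3"
    have d: "0 < d" using e by (simp add: d_def)
    obtain \<tau> where \<tau>: "\<tau> \<in> ?S T" "\<And>\<sigma>. \<sigma> \<in> ?S T \<Longrightarrow> V - d \<le> expected_reward T \<Gamma> \<sigma> \<tau>"
      using near(3)[OF T0(1) int(1) V d] by blast
    have ext: "extend_time T (Tn n) \<tau> \<in> ?S (Tn n)" for n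
      by (rule stopping_times_extend[OF \<tau>(1) T0(1) TTn])
    have "\<exists>\<sigma>\<in>?S (Tn n). expected_reward (Tn n) (\<Gamma>n n) \<sigma> (extend_time T (Tn n) \<tau>) \<le> Vn n + d" for n
      by (rule near(4)[OF T0(2) int(2) Vn d ext])
    then obtain \<sigma> where \<sigma>: "\<And>n. \<sigma> n \<in> ?S (Tn n)"
      "\<And>n. expected_reward (Tn n) (\<Gamma>n n) (\<sigma> n) (extend_time T (Tn n) \<tau>) \<le> Vn n + d"
      by metis
    let ?X = "\<lambda>n \<omega>. \<bar>U (max T (\<sigma> n \<omega>)) \<omega> - U T \<omega>\<bar>"
    have X: "integrable M (?X n)" "(\<lambda>n. expectation (?X n)) \<longlonglongrightarrow> 0" for n
      using gamma_minus max[OF \<sigma>(1)]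
      by (auto intro!: process_at_random_times_tendsto[OF _ _ T0(1) lim])
    have bound: "V \<le> Vn n + 2 * d + (expectation (?X n) + expectation (\<lambda>\<omega>. \<bar>\<Gamma>n n \<omega> - \<Gamma> \<omega>\<bar>))" for n
    proof -
      note min = stopping_times_min[OF \<sigma>(1)[of n] T0(1)]
      note i = game_reward_integrable[OF T0(2) int(2) \<sigma>(1) ext, of n]
      have "expected_reward T \<Gamma> (\<lambda>\<omega>. min (\<sigma> n \<omega>) T) \<tau>
          \<le> expectation (\<lambda>\<omega>. game_reward L U (Tn n) (\<Gamma>n n) (\<sigma> n) (extend_time T (Tn n) \<tau>) \<omega>
              + (?X n \<omega> + \<bar>\<Gamma>n n \<omega> - \<Gamma> \<omega>\<bar>))"
      proof (rule integral_mono_AE)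
        show "integrable M (game_reward L U T \<Gamma> (\<lambda>\<omega>. min (\<sigma> n \<omega>) T) \<tau>)"
          by (rule game_reward_integrable[OF T0(1) int(1) min \<tau>(1)])
        show "integrable M (\<lambda>\<omega>. game_reward L U (Tn n) (\<Gamma>n n) (\<sigma> n) (extend_time T (Tn n) \<tau>) \<omega>
            + (?X n \<omega> + \<bar>\<Gamma>n n \<omega> - \<Gamma> \<omega>\<bar>))"
          by (intro Bochner_Integration.integrable_add i X(1) err)
        show "AE \<omega> in M. game_reward L U T \<Gamma> (\<lambda>\<omega>. min (\<sigma> n \<omega>) T) \<tau> \<omega>
            \<le> game_reward L U (Tn n) (\<Gamma>n n) (\<sigma> n) (extend_time T (Tn n) \<tau>) \<omega>
              + (?X n \<omega> + \<bar>\<Gamma>n n \<omega> - \<Gamma> \<omega>\<bar>)"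
          using barrier stopping_times_D(2)[OF \<tau>(1)] stopping_times_D(2)[OF \<sigma>(1)[of n]]
          by eventually_elim (use TTn[of n] in \<open>auto intro!: game_reward_extend_maximiser\<close>)
      qed
      also have "\<dots> = expected_reward (Tn n) (\<Gamma>n n) (\<sigma> n) (extend_time T (Tn n) \<tau>)
          + (expectation (?X n) + expectation (\<lambda>\<omega>. \<bar>\<Gamma>n n \<omega> - \<Gamma> \<omega>\<bar>))"
        using i X(1) err by simp
      finally show ?thesis using \<sigma>(2)[of n] \<tau>(2)[OF min] by linarith
    qed
    have "\<forall>\<^sub>F n in sequentially. expectation (?X n) + expectation (\<lambda>\<omega>. \<bar>\<Gamma>n n \<omega> - \<Gamma> \<omega>\<bar>) < d"
      using tendsto_add[OF X(2) \<Gamma>lim] d by (intro order_tendstoD) auto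
    then show ?thesis
    proof eventually_elim
      case (elim n)
      then show ?case using bound[of n] by (simp add: d_def)
    qed
  qed
  show ?thesis
  proof (rule order_tendstoI)
    show "\<forall>\<^sub>F n in sequentially. a < Vn n" if "a < V" for a using lower[of "V - a"] that by simp
    show "\<forall>\<^sub>F n in sequentially. Vn n < a" if "V < a" for a using upper[of "a - V"] that by simp
  qed
qed

end

section \<open>Continuity of the value in the horizon\<close>

theorem theorem5p3:
  fixes M :: "'a measure"
    and B gamma_minus gamma_plus L U :: "real \<Rightarrow> 'a \<Rightarrow> real"
    and F :: "real \<Rightarrow> 'a measure"
  assumes setting: "dynkin_setting M B gamma_minus gamma_plus"
    and F: "F = completed_filtration M B"
    and L: "L = (\<lambda>t \<omega>. - gamma_plus t \<omega>)"
    and U: "U = gamma_minus"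
  shows "(\<forall>T Tn \<Gamma> \<Gamma>n V Vn.
            0 < T \<longrightarrow> decreases_to Tn T \<longrightarrow>
            terminal_value M F L U T \<Gamma> \<longrightarrow> admissible_sequence M F L U Tn \<Gamma>n \<Gamma> \<longrightarrow>
            game_value M F L U T \<Gamma> V \<longrightarrow> (\<forall>n. game_value M F L U (Tn n) (\<Gamma>n n) (Vn n)) \<longrightarrow>
            (\<lambda>n. \<bar>Vn n - V\<bar>\<^sup>2) \<longlonglongrightarrow> 0)
       \<and> (\<forall>\<Gamma> V.
            (\<forall>T>0. terminal_value M F L U T (\<Gamma> T)) \<longrightarrow>
            (\<forall>T>0. \<forall>Tn. decreases_to Tn T \<longrightarrow>
               admissible_sequence M F L U Tn (\<lambda>n. \<Gamma> (Tn n)) (\<Gamma> T)) \<longrightarrow>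
            (\<forall>T>0. game_value M F L U T (\<Gamma> T) (V T)) \<longrightarrow>
            (\<forall>T>0. continuous (at_right T) V))"
proof -
  interpret dynkin_setting M B gamma_minus gamma_plus by (rule setting)
  show ?thesis
    unfolding F L U
  proof (intro conjI allI impI)
    fix T Tn \<Gamma> \<Gamma>n V Vn
    assume "0 < T" "decreases_to Tn T"
      "terminal_value M (completed_filtration M B) (\<lambda>t \<omega>. - gamma_plus t \<omega>) gamma_minus T \<Gamma>"
      "admissible_sequence M (completed_filtration M B) (\<lambda>t \<omega>. - gamma_plus t \<omega>) gamma_minus Tn \<Gamma>n \<Gamma>"
      "game_value M (completed_filtration M B) (\<lambda>t \<omega>. - gamma_plus t \<omega>) gamma_minus T \<Gamma> V"
      "\<forall>n. game_value M (completed_filtration M B) (\<lambda>t \<omega>. - gamma_plus t \<omega>) gamma_minus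
         (Tn n) (\<Gamma>n n) (Vn n)"
    then have "Vn \<longlonglongrightarrow> V" by (intro game_value_tendsto) auto
    then have "(\<lambda>n. \<bar>Vn n - V\<bar>\<^sup>2) \<longlonglongrightarrow> \<bar>V - V\<bar>\<^sup>2" by (intro tendsto_intros)
    then show "(\<lambda>n. \<bar>Vn n - V\<bar>\<^sup>2) \<longlonglongrightarrow> 0" by simp
  next
    fix \<Gamma> V and T :: real
    assume \<Gamma>: "\<forall>T>0. terminal_value M (completed_filtration M B) (\<lambda>t \<omega>. - gamma_plus t \<omega>)
          gamma_minus T (\<Gamma> T)"
      and adm: "\<forall>T>0. \<forall>Tn. decreases_to Tn T \<longrightarrow>
          admissible_sequence M (completed_filtration M B) (\<lambda>t \<omega>. - gamma_plus t \<omega>) gamma_minus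
            Tn (\<lambda>n. \<Gamma> (Tn n)) (\<Gamma> T)"
      and V: "\<forall>T>0. game_value M (completed_filtration M B) (\<lambda>t \<omega>. - gamma_plus t \<omega>) gamma_minus
          T (\<Gamma> T) (V T)"
      and T: "0 < T"
    have "(V \<longlongrightarrow> V T) (at_right T)"
    \<comment> \<open>Right limits are tested on decreasing sequences above \<open>T\<close>; the
      right end \<open>T + 1\<close> is an arbitrary choice.\<close>
    proof (rule tendsto_at_right_sequentially[of T "T + 1"])
      fix Tn :: "nat \<Rightarrow> real"
      assume Tn: "\<And>n. T < Tn n" "decseq Tn" "Tn \<longlonglongrightarrow> T"
      have pos: "0 < Tn n" for n using T Tn(1) by (rule less_trans)
      then have dec: "decreases_to Tn T" using Tn by (simp add: decreases_to_def)
      show "(\<lambda>n. V (Tn n)) \<longlonglongrightarrow> V T"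
        by (rule game_value_tendsto[OF T dec]) (use \<Gamma> adm V T dec pos in auto)
    qed simp
    then show "continuous (at_right T) V" by (simp add: continuous_within)
  qed
qed

end
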